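(* Let $D$ be a connected regular oriented graph such that $H_\omega(D)$ has exactly two distinct eigenvalues $r>s$. Then the following are equivalent: (1) $r=2$; (2) the underlying graph of $D$ is triangle-free; (3) the underlying graph of $D$ is isomorphic to $K_{5,5}-M$, the graph obtained from $K_{5,5}$ by deleting the edges of a perfect matching.
   Context: An oriented graph $D=(V,A)$ is a loopless directed graph in which for each pair of distinct vertices $u,v$ at most one of $(u,v),(v,u)$ is an arc; write $u\to v$ if $(u,v)\in A$. Its underlying graph is the simple graph with an edge $\{u,v\}$ whenever $u\to v$ or $v\to u$; $D$ is connected if its underlying graph is. $D$ is regular if all in-degrees and out-degrees of all vertices are equal. Let $\omega=\frac{1+i\sqrt3}{2}$. The Hermitian adjacency matrix $H_\omega(D)$ has $(u,v)$-entry $\omega$ if $u\to v$, $\overline{\omega}$ if $v\to u$, and $0$ otherwise. *)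

theory Defs
  imports
    "Graph_Theory.Graph_Theory"
    "Jordan_Normal_Form.Spectral_Radius"
begin

text \<open>
  A digraph \<open>D = (V, A)\<close> is a pair digraph, whose arcs are pairs of vertices; the locale
  \<^locale>\<open>pair_digraph\<close> makes it finite and loopless.  The underlying simple graph is
  \<^term>\<open>mk_symmetric (with_proj D)\<close>, i.e. an undirected edge is a pair of opposite arcs.
\<close>

locale oriented_graph = pair_digraph G for G :: "'a pair_pre_digraph" (structure) +
  assumes antiparallel_free: "(u, v) \<in> parcs G \<Longrightarrow> (v, u) \<notin> parcs G"

definition regular_digraph :: "('a, 'b) pre_digraph \<Rightarrow> bool" where
  "regular_digraph G \<longleftrightarrow> (\<exists>k. \<forall>v \<in> verts G. in_degree G v = k \<and> out_degree G v = k)"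

abbreviation underlying_graph :: "'a pair_pre_digraph \<Rightarrow> 'a pair_pre_digraph" where
  "underlying_graph D \<equiv> mk_symmetric (with_proj D)"

definition \<omega> :: complex where
  "\<omega> = (1 + \<i> * complex_of_real (sqrt 3)) / 2"

text \<open>
  Matrices are indexed by natural numbers, so the vertices are enumerated by a list \<open>vs\<close>,
  meant to list every vertex exactly once.
\<close>

definition hermitian_adjacency :: "'a pair_pre_digraph \<Rightarrow> 'a list \<Rightarrow> complex mat" where
  "hermitian_adjacency D vs = mat (length vs) (length vs) (\<lambda>(i, j).
     if (vs ! i, vs ! j) \<in> parcs D then \<omega>
     else if (vs ! j, vs ! i) \<in> parcs D then cnj \<omega>
     else 0)"

definition triangle_free :: "'a pair_pre_digraph \<Rightarrow> bool" where
  "triangle_free G \<longleftrightarrow> \<not> (\<exists>u v w. distinct [u, v, w] \<and>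
     (u, v) \<in> parcs G \<and> (v, w) \<in> parcs G \<and> (w, u) \<in> parcs G)"

definition perfect_matching :: "'a pair_pre_digraph \<Rightarrow> ('a \<times> 'a) set \<Rightarrow> bool" where
  "perfect_matching G M \<longleftrightarrow> M \<subseteq> parcs G \<and> sym M \<and> (\<forall>u \<in> pverts G. \<exists>!v. (u, v) \<in> M)"

definition K55 :: "(bool \<times> nat) pair_pre_digraph" where
  "K55 = \<lparr> pverts = UNIV \<times> {..<5},
           parcs = {((a, i), (b, j)). a \<noteq> b \<and> i < 5 \<and> j < 5} \<rparr>"

definition M55 :: "((bool \<times> nat) \<times> (bool \<times> nat)) set" where
  "M55 = {((a, i), (b, j)). a \<noteq> b \<and> i = j \<and> i < 5}"

text \<open>
  All perfect matchings of \<open>K\<^bsub>5,5\<^esub>\<close> are equivalent under its automorphisms, so up to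
  isomorphism the choice of \<open>M55\<close> is immaterial.
\<close>

definition K55_minus_M :: "(bool \<times> nat) pair_pre_digraph" where
  "K55_minus_M = K55 \<lparr> parcs := parcs K55 - M55 \<rparr>"

lemma complete_bipartite_K55: "K\<^bsub>5,5\<^esub> (with_proj K55)"
  unfolding complete_bipartite_digraph_pair_def
proof (intro conjI exI)
  show "finite (pverts K55)"
    by (simp add: K55_def)
  show "pverts K55 = {True} \<times> {..<5} \<union> {False} \<times> {..<5}"
    by (auto simp: K55_def)
  show "parcs K55 = ({True} \<times> {..<5}) \<times> ({False} \<times> {..<5}) \<union>
      ({False} \<times> {..<5}) \<times> ({True} \<times> {..<5})"
    by (auto simp: K55_def)
qed auto

lemma perfect_matching_M55: "perfect_matching K55 M55"
proof -
  have "\<exists>!v. (u, v) \<in> M55" if "u \<in> pverts K55" for u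
    using that by (intro ex1I[of _ "(\<not> fst u, snd u)"]) (auto simp: K55_def M55_def)
  then show ?thesis
    by (auto simp: perfect_matching_def K55_def M55_def sym_def)
qed

end

theory Submission
  imports Defs "Jordan_Normal_Form.Jordan_Normal_Form_Uniqueness"
begin

text \<open>
  Since \<open>H = H\<^sub>\<omega>(D)\<close> is Hermitian with two eigenvalues, \<open>H\<^sup>2 = (r + s) H - r s I\<close>.  The all-ones
  vector is an eigenvector for the degree \<open>k\<close>, and the diagonal gives \<open>2 k = - r s\<close>, so \<open>r = k\<close> and
  \<open>s = - 2\<close>.  The entry of \<open>H\<^sup>2\<close> at an arc without common neighbours forces \<open>r = 2\<close>.  Conversely, for
  \<open>r = 2\<close> distinct rows of \<open>H\<close> are orthogonal; the products \<open>H\<^sub>u\<^sub>w H\<^sub>w\<^sub>v\<close> are cube roots of unity, which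
  sum to zero only if each occurs equally often.  Hence the number of common neighbours of two vertices is a
  multiple of 3 in a 4-regular graph, and this excludes triangles and pins the graph down to
  \<open>K\<^bsub>5,5\<^esub> - M\<close>.
\<close>

section \<open>Hermitian matrices with two eigenvalues\<close>

text \<open>Cyclicity of the trace, with the trace written as a plain sum of diagonal entries. It is
  used to see that conjugation by \<open>P\<close> and \<open>Q\<close> preserves the trace.\<close>

lemma sum_diag_mult_comm:
  fixes A B :: "'a :: comm_semiring_0 mat"
  assumes "A \<in> carrier_mat n m" "B \<in> carrier_mat m n"
  shows "(\<Sum>i<n. (A * B) $$ (i, i)) = (\<Sum>i<m. (B * A) $$ (i, i))"
proof -
  have "(\<Sum>i<n. (A * B) $$ (i, i)) = (\<Sum>i<n. \<Sum>j<m. A $$ (i, j) * B $$ (j, i))"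
    using assms by (simp add: scalar_prod_def lessThan_atLeast0)
  also have "\<dots> = (\<Sum>j<m. \<Sum>i<n. B $$ (j, i) * A $$ (i, j))"
    by (subst sum.swap) (simp add: mult.commute)
  also have "\<dots> = (\<Sum>i<m. (B * A) $$ (i, i))"
    using assms by (simp add: scalar_prod_def lessThan_atLeast0)
  finally show ?thesis .
qed

text \<open>A term \<open>X $$ (i, k) * Y $$ (k, j)\<close> can be nonzero only if i \<le> k \<le>
  j. On and below the diagonal this leaves at most the single term k = i = j.\<close>

lemma upper_triangular_mult_index:
  fixes X Y :: "'a :: semiring_0 mat"
  assumes X: "X \<in> carrier_mat n n" "upper_triangular X"
    and Y: "Y \<in> carrier_mat n n" "upper_triangular Y"
    and "i < n" "j \<le> i"
  shows "(X * Y) $$ (i, j) = (if i = j then X $$ (i, i) * Y $$ (i, i) else 0)"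
proof -
  have "(X * Y) $$ (i, j) = (\<Sum>k<n. X $$ (i, k) * Y $$ (k, j))"
    using assms by (simp add: scalar_prod_def lessThan_atLeast0)
  also have "\<dots> = (\<Sum>k<n. if k = i \<and> i = j then X $$ (i, i) * Y $$ (i, i) else 0)"
  proof (rule sum.cong)
    fix k assume k: "k \<in> {..<n}"
    consider "k < i" | "j < k" | "k = i" "i = j"
      using \<open>j \<le> i\<close> by linarith
    then show "X $$ (i, k) * Y $$ (k, j)
        = (if k = i \<and> i = j then X $$ (i, i) * Y $$ (i, i) else 0)"
      using assms k by cases (auto simp: upper_triangular_def)
  qed simp
  also have "\<dots> = (if i = j then X $$ (i, i) * Y $$ (i, i) else 0)"
    using \<open>i < n\<close> by (cases "i = j") auto
  finally show ?thesis .
qed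

text \<open>For Hermitian \<open>M\<close> the trace of \<open>M * M\<close> is the squared
  Frobenius norm of \<open>M\<close>, a sum of nonnegative reals, so it vanishes only if every entry
  does.\<close>

lemma hermitian_mat_eq_0:
  fixes M :: "complex mat"
  assumes M: "M \<in> carrier_mat n n"
    and herm: "\<And>i j. i < n \<Longrightarrow> j < n \<Longrightarrow> M $$ (j, i) = cnj (M $$ (i, j))"
    and tr: "(\<Sum>i<n. (M * M) $$ (i, i)) = 0"
  shows "M = 0\<^sub>m n n"
proof -
  have "(\<Sum>i<n. (M * M) $$ (i, i)) = (\<Sum>i<n. \<Sum>j<n. M $$ (i, j) * M $$ (j, i))"
    using M by (simp add: scalar_prod_def lessThan_atLeast0)
  also have "\<dots> = (\<Sum>i<n. \<Sum>j<n. complex_of_real ((cmod (M $$ (i, j)))\<^sup>2))"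
  proof (intro sum.cong refl)
    fix i j assume "i \<in> {..<n}" "j \<in> {..<n}"
    then have "M $$ (j, i) = cnj (M $$ (i, j))"
      by (intro herm) auto
    then show "M $$ (i, j) * M $$ (j, i) = complex_of_real ((cmod (M $$ (i, j)))\<^sup>2)"
      using complex_norm_square[of "M $$ (i, j)"] by simp
  qed
  also have "\<dots> = complex_of_real (\<Sum>i<n. \<Sum>j<n. (cmod (M $$ (i, j)))\<^sup>2)"
    by simp
  finally have "complex_of_real (\<Sum>i<n. \<Sum>j<n. (cmod (M $$ (i, j)))\<^sup>2) = 0"
    unfolding tr by (rule sym)
  then have "(\<Sum>i<n. \<Sum>j<n. (cmod (M $$ (i, j)))\<^sup>2) = 0"
    by (simp only: of_real_eq_0_iff)
  then have "\<forall>i<n. \<forall>j<n. M $$ (i, j) = 0"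
    by (simp add: sum_nonneg_eq_0_iff sum_nonneg)
  then show ?thesis
    using M by (intro eq_matI) auto
qed

text \<open>The inner factor \<open>Q * P\<close> cancels because both similarities use the same
  change of basis. This carries products of characteristic matrices of \<open>A\<close> over to
  those of \<open>B\<close>.\<close>

lemma similar_mat_wit_mult:
  assumes "similar_mat_wit A B P Q" "similar_mat_wit A' B' P Q"
    and A: "A \<in> carrier_mat n n" "A' \<in> carrier_mat n n"
  shows "similar_mat_wit (A * A') (B * B') P Q"
proof -
  note w = similar_mat_witD2[OF A(1) assms(1)] and w' = similar_mat_witD2[OF A(2) assms(2)]
  have "A * A' = P * B * (Q * (P * (B' * Q)))"
    unfolding w(3) w'(3) using w(4-) w'(4-) by (simp add: assoc_mult_mat[of _ n n _ n _ n])
  also have "Q * (P * (B' * Q)) = (Q * P) * (B' * Q)"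
    using w(4-) w'(4-) by (simp add: assoc_mult_mat[of _ n n _ n _ n])
  also have "P * B * \<dots> = P * (B * B') * Q"
    using w w' by (simp add: assoc_mult_mat[of _ n n _ n _ n])
  finally show ?thesis
    using w w' by (intro similar_mat_witI[of _ _ n]) auto
qed

text \<open>
  Triangularising \<open>A\<close> makes \<open>M = (A - r I) (A - s I)\<close> similar to a strictly upper triangular matrix, so
  \<open>M\<^sup>2\<close> has trace \<open>0\<close>; for Hermitian \<open>M\<close> that trace is the sum of all \<open>\<bar>M\<^sub>i\<^sub>j\<bar>\<^sup>2\<close>.
\<close>

lemma hermitian_quadratic:
  fixes A :: "complex mat" and r s :: real
  assumes A: "A \<in> carrier_mat n n"
    and herm: "\<And>i j. i < n \<Longrightarrow> j < n \<Longrightarrow> A $$ (j, i) = cnj (A $$ (i, j))"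
    and spec: "spectrum A \<subseteq> {complex_of_real r, complex_of_real s}"
    and ij: "i < n" "j < n"
  shows "(\<Sum>k<n. A $$ (i, k) * A $$ (k, j))
    = of_real (r + s) * A $$ (i, j) - (if i = j then of_real (r * s) else 0)"
proof -
  obtain es where es: "char_poly A = (\<Prod>a\<leftarrow>es. [:- a, 1:])"
    using char_poly_factorized[OF A] by blast
  obtain B where B: "B \<in> carrier_mat n n" "upper_triangular B" "similar_mat A B"
    using schur_decomposition_exists[OF A es] by blast
  then obtain P Q where w: "similar_mat_wit A B P Q"
    unfolding similar_mat_def by blast
  note wD = similar_mat_witD2[OF A w]
  have diag: "B $$ (i, i) = of_real r \<or> B $$ (i, i) = of_real s" if "i < n" for i
  proof -
    have "char_poly A = (\<Prod>a\<leftarrow>diag_mat B. [:- a, 1:])"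
      using char_poly_similar[OF B(3)] char_poly_upper_triangular[OF B(1,2)] by simp
    moreover have "B $$ (i, i) \<in> set (diag_mat B)"
      using that B(1) by (auto simp: diag_mat_def)
    ultimately have "poly (char_poly A) (B $$ (i, i)) = 0"
      by (auto simp: poly_prod_list prod_list_zero_iff image_iff)
    then show ?thesis
      using spec spectrum_root_char_poly[OF A] by auto
  qed
  \<comment> \<open>\<open>f X\<close> is the polynomial (x - r)(x - s) evaluated at the matrix
    \<open>X\<close>. It is kept as a function so that one entry formula serves any matrix and
    \<open>f A\<close> can be compared with \<open>f B\<close>.\<close>
  define f where "f X = char_matrix X (of_real r) * char_matrix X (of_real s)" for X :: "complex mat"
  have f_index: "f X $$ (i, j) = (\<Sum>k<n. X $$ (i, k) * X $$ (k, j))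
      - of_real (r + s) * X $$ (i, j) + (if i = j then of_real (r * s) else 0)"
    if X: "X \<in> carrier_mat n n" and "i < n" "j < n" for X i j
  proof -
    have "f X $$ (i, j) = (\<Sum>k<n. (X $$ (i, k) - (if i = k then of_real r else 0))
        * (X $$ (k, j) - (if k = j then of_real s else 0)))"
      using that unfolding f_def char_matrix_def
      by (auto simp: scalar_prod_def lessThan_atLeast0 intro!: sum.cong)
    also have "\<dots> = (\<Sum>k<n. X $$ (i, k) * X $$ (k, j)
        - (if i = k then of_real r * X $$ (k, j) else 0)
        - (if k = j then of_real s * X $$ (i, k) else 0)
        + (if i = k then (if k = j then of_real r * of_real s else 0) else 0))"
      by (intro sum.cong) (auto simp: algebra_simps)
    also have "\<dots> = (\<Sum>k<n. X $$ (i, k) * X $$ (k, j)) - of_real r * X $$ (i, j)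
        - of_real s * X $$ (i, j) + (if i = j then of_real r * of_real s else 0)"
      using that by (simp add: sum.distrib sum_subtractf)
    finally show ?thesis by (simp add: algebra_simps)
  qed
  have fA: "f A \<in> carrier_mat n n" and fB: "f B \<in> carrier_mat n n"
    unfolding f_def using A B(1) by (auto intro!: mult_carrier_mat[of _ n n] char_matrix_closed)
  have wf: "similar_mat_wit (f A) (f B) P Q"
    unfolding f_def using w A
    by (intro similar_mat_wit_mult[of _ _ _ _ _ _ n] similar_mat_wit_char_matrix) auto
  then have "similar_mat_wit (f A * f A) (f B * f B) P Q"
    using fA by (intro similar_mat_wit_mult[of _ _ _ _ _ _ n])
  then have ff: "f A * f A = P * (f B * f B) * Q" "Q * P = 1\<^sub>m n"
    using fA similar_mat_witD2[of "f A * f A" n n "f B * f B" P Q] by auto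
  \<comment> \<open>The diagonal entries of \<open>f B\<close> are (b - r)(b - s) with b a diagonal
    entry of \<open>B\<close>, hence an eigenvalue of \<open>A\<close>; so the diagonal vanishes
    along with everything below it.\<close>
  have fB_low: "f B $$ (i, j) = 0" if "i < n" "j \<le> i" for i j
  proof -
    have "upper_triangular (char_matrix B c)" for c
      using B(1,2) by (auto simp: char_matrix_def upper_triangular_def)
    then have "f B $$ (i, j)
      = (if i = j then char_matrix B (of_real r) $$ (i, i) * char_matrix B (of_real s) $$ (i, i) else 0)"
      unfolding f_def using B(1) that by (intro upper_triangular_mult_index[of _ n]) auto
    then show ?thesis
      using diag[OF that(1)] that B(1) by (auto simp: char_matrix_def)
  qed
  then have fB_ut: "upper_triangular (f B)"
    using fB by (auto simp: upper_triangular_def)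
  have "(\<Sum>i<n. (f A * f A) $$ (i, i)) = (\<Sum>i<n. (P * ((f B * f B) * Q)) $$ (i, i))"
    using ff fB wD(6,7) by (simp add: assoc_mult_mat[of _ n n _ n _ n])
  also have "\<dots> = (\<Sum>i<n. (f B * f B * Q * P) $$ (i, i))"
    using fB wD(6,7) by (intro sum_diag_mult_comm) auto
  also have "f B * f B * Q * P = f B * f B"
    using ff(2) fB wD(6,7) by (simp add: assoc_mult_mat[of _ n n _ n _ n])
  also have "(\<Sum>i<n. (f B * f B) $$ (i, i)) = 0"
    using upper_triangular_mult_index[OF fB fB_ut fB fB_ut] fB_low by simp
  finally have tr: "(\<Sum>i<n. (f A * f A) $$ (i, i)) = 0" .
  \<comment> \<open>\<open>f A\<close> inherits the Hermitian property from \<open>A\<close> because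
    the coefficients r + s and r s are real.\<close>
  have "f A $$ (j, i) = cnj (f A $$ (i, j))" if "i < n" "j < n" for i j
  proof -
    have "(\<Sum>k<n. A $$ (j, k) * A $$ (k, i)) = (\<Sum>k<n. cnj (A $$ (i, k) * A $$ (k, j)))"
    proof (intro sum.cong refl)
      fix k assume "k \<in> {..<n}"
      then have "A $$ (j, k) = cnj (A $$ (k, j))" "A $$ (k, i) = cnj (A $$ (i, k))"
        using that by (auto intro: herm)
      then show "A $$ (j, k) * A $$ (k, i) = cnj (A $$ (i, k) * A $$ (k, j))"
        by simp
    qed
    then show ?thesis
      using that herm[OF that, symmetric] by (auto simp: f_index[OF A])
  qed
  then have "f A = 0\<^sub>m n n"
    using fA tr by (intro hermitian_mat_eq_0)
  then show ?thesis
    using f_index[OF A ij] ij by (simp add: algebra_simps)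
qed

section \<open>A characterisation of the graph K55 minus a perfect matching\<close>

text \<open>
  Having a common neighbour is transitive, since two 3-subsets of a 4-set meet.  The class \<open>U\<close> of a vertex
  is one side of the bipartition, and every vertex on the other side \<open>W\<close> misses exactly one vertex of \<open>U\<close>.
\<close>

lemma bij_betw_K55_minus_M:
  fixes E :: "'a rel"
  assumes fin: "finite V" and ne: "V \<noteq> {}"
    and E: "E \<subseteq> V \<times> V" "sym E"
    and conn: "\<And>u v. u \<in> V \<Longrightarrow> v \<in> V \<Longrightarrow> (u, v) \<in> E\<^sup>*"
    and tri: "\<And>u v w. (u, v) \<in> E \<Longrightarrow> (v, w) \<in> E \<Longrightarrow> (w, u) \<notin> E"
    and deg: "\<And>u. u \<in> V \<Longrightarrow> card (E `` {u}) = 4"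
    and common: "\<And>u v. u \<in> V \<Longrightarrow> v \<in> V \<Longrightarrow> u \<noteq> v \<Longrightarrow>
      E `` {u} \<inter> E `` {v} \<noteq> {} \<Longrightarrow> card (E `` {u} \<inter> E `` {v}) = 3"
  shows "\<exists>f. bij_betw f V (pverts K55_minus_M) \<and>
    (\<forall>x\<in>V. \<forall>y\<in>V. (x, y) \<in> E \<longleftrightarrow> (f x, f y) \<in> parcs K55_minus_M)"
proof -
  define N where "N u = E `` {u}" for u
  have N_iff: "v \<in> N u \<longleftrightarrow> (u, v) \<in> E" for u v by (simp add: N_def)
  have N_sym: "v \<in> N u \<longleftrightarrow> u \<in> N v" for u v
    using E(2) by (auto simp: N_def dest: symD)
  have N_V: "N u \<subseteq> V" "v \<in> N u \<Longrightarrow> u \<in> V" for u v using E(1) by (auto simp: N_def)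
  have N_fin: "finite (N u)" for u using N_V(1) fin by (rule finite_subset)
  have card_N: "card (N u) = 4" if "u \<in> V" for u using deg[OF that] by (simp add: N_def)
  \<comment> \<open>The triangle hypothesis does not ask for distinct vertices, so a loop would
    count as a triangle.\<close>
  have irr: "u \<notin> N u" for u using tri[of u u u] by (auto simp: N_iff)
  have card_NN: "card (N u \<inter> N v) = 3" if "u \<noteq> v" "w \<in> N u" "w \<in> N v" for u v w
    using common[of u v] that N_V(2) unfolding N_def by blast
  obtain u where u: "u \<in> V" using ne by blast
  define U where "U = {v \<in> V. v = u \<or> N u \<inter> N v \<noteq> {}}"
  have UV: "U \<subseteq> V" and uU: "u \<in> U" using u by (auto simp: U_def)
  have finU: "finite U" using UV fin by (rule finite_subset)
  have closed: "w \<in> U" if "v \<in> U" "x \<in> N v" "w \<in> N x" for v w x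
  proof (cases "v = u \<or> v = w")
    case True
    then show ?thesis using that N_V N_sym by (auto simp: U_def)
  next
    case False
    then have uv: "card (N u \<inter> N v) = 3" using that card_NN[of u v] by (auto simp: U_def)
    have vw: "card (N v \<inter> N w) = 3" using False that card_NN[of v w x] N_sym by blast
    have "card ((N u \<inter> N v) \<union> (N v \<inter> N w)) \<le> card (N v)"
      using N_fin by (intro card_mono) auto
    also have "\<dots> = 4" using card_N that(1) UV by auto
    finally have "(N u \<inter> N v) \<inter> (N v \<inter> N w) \<noteq> {}"
      using card_Un_disjoint[of "N u \<inter> N v" "N v \<inter> N w"] uv vw N_fin by auto
    then show ?thesis using that N_V by (auto simp: U_def)
  qed
  have N_U: "N x \<subseteq> U" if "v \<in> U" "x \<in> N v" for v x using closed that by blast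
  have cardU: "card U = 5"
  proof -
    \<comment> \<open>Double counting of the paths u - x - v with v \<noteq> u: each v in
      \<open>U - {u}\<close> has 3 common neighbours with u, and each of the 4 neighbours x of u has
      3 neighbours besides u. Thus 3 |U - {u}| = 12.\<close>
    have "(\<Sum>v\<in>U - {u}. card (N u \<inter> N v)) = (\<Sum>v\<in>U - {u}. \<Sum>x\<in>N u. if v \<in> N x then 1 else 0)"
      using N_fin N_sym by (intro sum.cong refl) (simp add: sum.If_cases Int_def)
    also have "\<dots> = (\<Sum>x\<in>N u. card (N x - {u}))"
    proof (subst sum.swap, intro sum.cong refl)
      fix x assume "x \<in> N u"
      then have "(U - {u}) \<inter> N x = N x - {u}" using N_U[OF uU] by blast
      then show "(\<Sum>v\<in>U - {u}. if v \<in> N x then 1 else 0) = card (N x - {u})"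
        using finU by (simp add: sum.If_cases Int_def)
    qed
    also have "\<dots> = (\<Sum>x\<in>N u. 3)"
      using N_sym N_V card_N by (intro sum.cong refl) (subst card_Diff_singleton, auto)
    also have "\<dots> = 12" using card_N[OF u] by simp
    also have "(\<Sum>v\<in>U - {u}. card (N u \<inter> N v)) = (\<Sum>v\<in>U - {u}. 3)"
      using card_NN by (intro sum.cong refl) (auto simp: U_def)
    finally have "card (U - {u}) = 4" by simp
    then show ?thesis using uU finU by (simp add: card_Diff_singleton)
  qed
  define W where "W = (\<Union>v\<in>U. N v)"
  have WV: "W \<subseteq> V" using N_V by (auto simp: W_def)
  have finW: "finite W" using WV fin by (rule finite_subset)
  have NW: "N x \<subseteq> U" if "x \<in> W" for x using that N_U by (auto simp: W_def)
  have NU: "N v \<subseteq> W" if "v \<in> U" for v using that by (auto simp: W_def)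
  \<comment> \<open>Along a path from \<open>u\<close> the edges lead alternately from
    \<open>U\<close> into \<open>W\<close> and from \<open>W\<close> into \<open>U\<close>, and
    connectedness reaches every vertex.\<close>
  have V: "V = U \<union> W"
  proof
    show "V \<subseteq> U \<union> W"
    proof
      fix v assume "v \<in> V"
      with conn u have "(u, v) \<in> E\<^sup>*" by blast
      then show "v \<in> U \<union> W"
      proof induction
        case (step y z)
        then have "z \<in> N y" by (simp add: N_iff)
        with step.IH NU NW show ?case by blast
      qed (use uU in simp)
    qed
  qed (use UV WV in auto)
  \<comment> \<open>A vertex x in both sets has a neighbour v in \<open>U\<close>, and then
    \<open>N x\<close> and \<open>N v\<close> both lie in \<open>U\<close>. They are disjoint, as
    there is no triangle on the edge x v, so \<open>U\<close> would have at least 8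
    elements.\<close>
  have disj: "U \<inter> W = {}"
  proof (rule ccontr)
    assume "U \<inter> W \<noteq> {}"
    then obtain x v where x: "x \<in> U" "v \<in> U" "x \<in> N v" by (auto simp: W_def)
    have xv: "N x \<subseteq> U" "N v \<subseteq> U" using N_U x N_sym by blast+
    have cap: "N x \<inter> N v = {}" using tri x N_iff N_sym by blast
    have "card (N x) = 4" "card (N v) = 4" using card_N x UV by blast+
    then have "card (N x \<union> N v) = 8"
      using cap N_fin by (simp add: card_Un_disjoint)
    moreover have "card (N x \<union> N v) \<le> card U" using xv finU by (intro card_mono) auto
    ultimately show False using cardU by simp
  qed
  have cardW: "card W = 5"
  proof -
    \<comment> \<open>The edges between \<open>U\<close> and \<open>W\<close> are counted from both
      sides: 4 |W| = 4 |U|.\<close>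
    have "(\<Sum>x\<in>W. card (N x)) = (\<Sum>x\<in>W. \<Sum>v\<in>U. if v \<in> N x then 1 else 0)"
    proof (intro sum.cong refl)
      fix x assume "x \<in> W"
      then have "U \<inter> N x = N x" using NW by blast
      then show "card (N x) = (\<Sum>v\<in>U. if v \<in> N x then 1 else 0)"
        using finU by (simp add: sum.If_cases Int_def)
    qed
    also have "\<dots> = (\<Sum>v\<in>U. card (N v))"
    proof (subst sum.swap, intro sum.cong refl)
      fix v assume "v \<in> U"
      then have "W \<inter> N v = N v" using NU by blast
      then show "(\<Sum>x\<in>W. if v \<in> N x then 1 else 0) = card (N v)"
        using finW N_sym[of v] by (simp add: sum.If_cases Int_def)
    qed
    also have "\<dots> = (\<Sum>v\<in>U. 4)" using card_N UV by (intro sum.cong) auto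
    also have "(\<Sum>x\<in>W. card (N x)) = (\<Sum>x\<in>W. 4)" using card_N WV by (intro sum.cong) auto
    finally show ?thesis using cardU by simp
  qed
  have "\<exists>v\<in>U. N x = U - {v}" if "x \<in> W" for x
  proof -
    have "card (U - N x) = 1"
      using card_Diff_subset[OF N_fin NW] that cardU card_N WV by auto
    then obtain v where "U - N x = {v}" by (auto simp: card_1_singleton_iff)
    then show ?thesis using NW[OF that] by blast
  qed
  then obtain m where m: "\<And>x. x \<in> W \<Longrightarrow> m x \<in> U \<and> N x = U - {m x}" by metis
  \<comment> \<open>Two vertices of \<open>W\<close> missing the same vertex of \<open>U\<close>
    would have equal neighbourhoods, hence 4 common neighbours instead of 3.\<close>
  have "inj_on m W"
  proof (rule inj_onI, rule ccontr)
    fix x y assume xy: "x \<in> W" "y \<in> W" "m x = m y" "x \<noteq> y"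
    then have "N x = N y" using m by metis
    moreover have "card (N x) = 4" using xy WV card_N by blast
    moreover from this obtain w where "w \<in> N x" by fastforce
    ultimately show False using card_NN[of x y w] xy by auto
  qed
  moreover from this have "m ` W = U"
    using m finU cardU cardW by (intro card_subset_eq) (auto simp: card_image)
  ultimately have bij_m: "bij_betw m W U" by (simp add: bij_betw_def)
  obtain g where g: "bij_betw g U {..<5::nat}"
    using ex_bij_betw_finite_nat[OF finU] cardU by (auto simp: lessThan_atLeast0)
  \<comment> \<open>\<open>U\<close> is numbered arbitrarily by \<open>g\<close>, and each vertex of
    \<open>W\<close> receives the number of the one vertex of \<open>U\<close> that it misses. The
    non-adjacent pairs across the bipartition thus become exactly the pairs of
    \<open>M55\<close>.\<close>
  define f where "f x = (if x \<in> U then (False, g x) else (True, g (m x)))" for x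
  have gm: "bij_betw (g \<circ> m) W {..<5::nat}" using bij_betw_trans[OF bij_m g] .
  have "bij_betw f U ({False} \<times> {..<5})"
    using g by (auto simp: bij_betw_def f_def inj_on_def image_iff)
  moreover have "bij_betw f W ({True} \<times> {..<5})"
  proof -
    have "bij_betw (\<lambda>x. (True, (g \<circ> m) x)) W ({True} \<times> {..<5})"
      using gm by (auto simp: bij_betw_def inj_on_def image_iff)
    moreover have "f x = (True, (g \<circ> m) x)" if "x \<in> W" for x using that disj by (auto simp: f_def)
    ultimately show ?thesis by (simp cong: bij_betw_cong)
  qed
  ultimately have "bij_betw f (U \<union> W) ({False} \<times> {..<5} \<union> {True} \<times> {..<5})"
    by (rule bij_betw_combine) auto
  also have "{False} \<times> {..<5} \<union> {True} \<times> {..<5} = pverts K55_minus_M"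
    by (auto simp: K55_minus_M_def K55_def)
  finally have bij: "bij_betw f V (pverts K55_minus_M)" by (simp add: V)
  have K_iff: "((a, i), (b, j)) \<in> parcs K55_minus_M \<longleftrightarrow> a \<noteq> b \<and> i \<noteq> j \<and> i < 5 \<and> j < 5" for a b i j
    by (auto simp: K55_minus_M_def K55_def M55_def)
  have g5: "g x < 5" if "x \<in> U" for x using g that by (auto simp: bij_betw_def)
  have UW: "(x, y) \<in> E \<longleftrightarrow> g x \<noteq> g (m y)" if "x \<in> U" "y \<in> W" for x y
  proof -
    have "(x, y) \<in> E \<longleftrightarrow> x \<noteq> m y" using m[of y] that N_iff N_sym by blast
    also have "\<dots> \<longleftrightarrow> g x \<noteq> g (m y)"
      using g m that by (auto simp: bij_betw_def inj_on_def)
    finally show ?thesis .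
  qed
  have "(x, y) \<in> E \<longleftrightarrow> (f x, f y) \<in> parcs K55_minus_M" if "x \<in> V" "y \<in> V" for x y
  proof -
    consider "x \<in> U" "y \<in> U" | "x \<in> U" "y \<in> W" | "x \<in> W" "y \<in> U" | "x \<in> W" "y \<in> W"
      using \<open>x \<in> V\<close> \<open>y \<in> V\<close> V by blast
    then show ?thesis
    proof cases
      case 1
      then have "(x, y) \<notin> E" using NU N_iff disj by blast
      with 1 show ?thesis by (simp add: f_def K_iff)
    next
      case 2
      then have "y \<notin> U" using disj by blast
      with 2 show ?thesis using UW[OF 2] g5 m by (simp add: f_def K_iff)
    next
      case 3
      then have "x \<notin> U" using disj by blast
      moreover have "(x, y) \<in> E \<longleftrightarrow> (y, x) \<in> E" using N_sym N_iff by blast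
      ultimately show ?thesis using 3 UW[OF 3(2,1)] g5 m by (auto simp: f_def K_iff)
    next
      case 4
      then have "(x, y) \<notin> E" using NW N_iff disj by blast
      moreover have "x \<notin> U" "y \<notin> U" using 4 disj by auto
      ultimately show ?thesis by (simp add: f_def K_iff)
    qed
  qed
  with bij show ?thesis by blast
qed

section \<open>Isomorphisms of pair digraphs described by vertex maps\<close>

text \<open>An isomorphism is a record that also maps arcs and prescribes head and tail functions.
  For pair digraphs these are determined by the vertex map: \<open>map_prod f f\<close> on arcs,
  with the projections as tail and head.\<close>

lemma digraph_iso_with_projI:
  fixes G :: "'a pair_pre_digraph" and H :: "'b pair_pre_digraph"
  assumes wf: "pair_wf_digraph G" "pair_wf_digraph H"
    and bij: "bij_betw f (pverts G) (pverts H)"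
    and arcs: "\<And>x y. x \<in> pverts G \<Longrightarrow> y \<in> pverts G \<Longrightarrow> (x, y) \<in> parcs G \<longleftrightarrow> (f x, f y) \<in> parcs H"
  shows "digraph_iso (with_proj G) (with_proj H)"
proof -
  interpret G: pair_wf_digraph G by fact
  interpret H: pair_wf_digraph H by fact
  define h where "h = \<lparr>iso_verts = f, iso_arcs = map_prod f f,
    iso_head = snd :: 'b \<times> 'b \<Rightarrow> 'b, iso_tail = fst :: 'b \<times> 'b \<Rightarrow> 'b\<rparr>"
  have inj: "inj_on f (pverts G)" using bij by (simp add: bij_betw_def)
  have "inj_on (map_prod f f) (parcs G)"
    using map_prod_inj_on[OF inj inj] by (rule inj_on_subset) (auto dest: G.wellformed')
  then have "pre_digraph.digraph_isomorphism (with_proj G) h"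
    using inj wf(1) unfolding pre_digraph.digraph_isomorphism_def
    by (auto simp: h_def wf_digraph_wp_iff)
  moreover have "map_prod f f ` parcs G = parcs H"
  proof
    show "map_prod f f ` parcs G \<subseteq> parcs H"
      using arcs by (auto dest: G.wellformed')
    show "parcs H \<subseteq> map_prod f f ` parcs G"
    proof
      fix e assume "e \<in> parcs H"
      then obtain x y where "e = (f x, f y)" "x \<in> pverts G" "y \<in> pverts G"
        using bij H.wellformed' unfolding bij_betw_def by (metis imageE surj_pair)
      then show "e \<in> map_prod f f ` parcs G"
        using arcs \<open>e \<in> parcs H\<close> by force
    qed
  qed
  then have "with_proj H = app_iso h (with_proj G)"
    using bij by (simp add: app_iso_def with_proj_def h_def bij_betw_def)
  ultimately show ?thesis unfolding digraph_iso_def by blast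
qed

text \<open>Tail and head in the target are the projections, so the arc map must act by
  \<open>iso_verts h\<close> on both components. Only the resulting homomorphism is extracted, which
  suffices to pull back a 2-colouring.\<close>

lemma digraph_iso_with_projE:
  assumes "digraph_iso (with_proj G) (with_proj H)"
  obtains f where "\<And>x y. (x, y) \<in> parcs G \<Longrightarrow> (f x, f y) \<in> parcs H"
proof -
  from assms obtain h where h: "pre_digraph.digraph_isomorphism (with_proj G) h"
    and H: "with_proj H = app_iso h (with_proj G)"
    unfolding digraph_iso_def by blast
  have "arcs (with_proj H) = iso_arcs h ` parcs G" "tail (with_proj H) = iso_tail h"
    "head (with_proj H) = iso_head h"
    unfolding H by simp_all
  then have H': "parcs H = iso_arcs h ` parcs G" "iso_tail h = fst" "iso_head h = snd"
    by simp_all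
  have "(iso_verts h x, iso_verts h y) \<in> parcs H" if "(x, y) \<in> parcs G" for x y
  proof -
    have "iso_arcs h (x, y) = (iso_verts h x, iso_verts h y)"
      using h that H'(2,3) unfolding pre_digraph.digraph_isomorphism_def
      by (force simp: prod_eq_iff)
    then show ?thesis using H'(1) that by (metis imageI)
  qed
  then show thesis by (rule that)
qed

text \<open>The Boolean component of the image is a proper 2-colouring, and a triangle has
  none.\<close>

lemma triangle_free_if_iso_K55_minus_M:
  assumes "digraph_iso (with_proj G) (with_proj K55_minus_M)"
  shows "triangle_free G"
proof -
  obtain f where f: "\<And>x y. (x, y) \<in> parcs G \<Longrightarrow> (f x, f y) \<in> parcs K55_minus_M"
    using digraph_iso_with_projE[OF assms] by blast
  have "fst (f x) \<noteq> fst (f y)" if "(x, y) \<in> parcs G" for x y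
    using f[OF that] by (auto simp: K55_minus_M_def K55_def)
  then show ?thesis unfolding triangle_free_def by metis
qed

section \<open>The Hermitian adjacency matrix of an oriented graph\<close>

text \<open>\<omega> is a primitive sixth root of unity, so \<open>\<omega> * \<omega>\<close> and
  \<open>cnj \<omega> * cnj \<omega>\<close> are the two nontrivial cube roots of unity.\<close>

lemma omega_simps:
  "\<omega> + cnj \<omega> = 1" "\<omega> * cnj \<omega> = 1" "cnj \<omega> * \<omega> = 1"
  "\<omega> * \<omega> = Complex (-1/2) (sqrt 3 / 2)" "cnj \<omega> * cnj \<omega> = Complex (-1/2) (- sqrt 3 / 2)"
  "\<omega> \<noteq> 0"
  by (simp_all add: \<omega>_def complex_eq_iff)

text \<open>The imaginary part gives a = b and the real part gives c = (a + b) / 2.\<close>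

lemma Eisenstein_sum_eq_0:
  assumes "of_nat a * (\<omega> * \<omega>) + of_nat b * (cnj \<omega> * cnj \<omega>) + of_nat c = 0"
  shows "a = c" "b = c"
proof -
  have "real c = real a / 2 + real b / 2" "real a * sqrt 3 = real b * sqrt 3"
    using assms by (simp_all add: omega_simps complex_eq_iff)
  then show "a = c" "b = c" by simp_all
qed

text \<open>The matrix entry indexed by vertices instead of list positions, which frees the later
  sums from the enumeration \<open>vs\<close>.\<close>

definition arc_weight :: "'a pair_pre_digraph \<Rightarrow> 'a \<Rightarrow> 'a \<Rightarrow> complex" where
  "arc_weight D u v = (if (u, v) \<in> parcs D then \<omega> else if (v, u) \<in> parcs D then cnj \<omega> else 0)"

lemma hermitian_adjacency_carrier:
  "hermitian_adjacency D vs \<in> carrier_mat (length vs) (length vs)"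
  by (simp add: hermitian_adjacency_def)

lemma hermitian_adjacency_index:
  "i < length vs \<Longrightarrow> j < length vs \<Longrightarrow>
    hermitian_adjacency D vs $$ (i, j) = arc_weight D (vs ! i) (vs ! j)"
  by (simp add: hermitian_adjacency_def arc_weight_def)

lemma sum_nth_distinct:
  "distinct vs \<Longrightarrow> (\<Sum>k<length vs. f (vs ! k)) = (\<Sum>v\<in>set vs. f v)"
  by (rule sum.reindex_bij_betw[OF bij_betw_nth]) auto

lemma parcs_underlying_graph [simp]:
  "(u, v) \<in> parcs (underlying_graph D) \<longleftrightarrow> (u, v) \<in> parcs D \<or> (v, u) \<in> parcs D"
  by (auto simp: parcs_mk_symmetric intro: bexI[of _ "(u, v)"] bexI[of _ "(v, u)"])

context oriented_graph
begin

lemma cnj_arc_weight: "cnj (arc_weight G u v) = arc_weight G v u"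
  using antiparallel_free by (auto simp: arc_weight_def)

lemma arc_weight_self [simp]: "arc_weight G u u = 0"
  using antiparallel_free by (auto simp: arc_weight_def)

lemma spectrum_quadratic:
  assumes vs: "distinct vs" "set vs = pverts G"
    and spec: "spectrum (hermitian_adjacency G vs) = {complex_of_real r, complex_of_real s}"
    and uv: "u \<in> pverts G" "v \<in> pverts G"
  shows "(\<Sum>w\<in>pverts G. arc_weight G u w * arc_weight G w v)
    = of_real (r + s) * arc_weight G u v - (if u = v then of_real (r * s) else 0)"
proof -
  obtain i j where ij: "i < length vs" "j < length vs" "u = vs ! i" "v = vs ! j"
    using uv vs(2) by (metis in_set_conv_nth)
  let ?H = "hermitian_adjacency G vs"
  have "?H $$ (j, i) = cnj (?H $$ (i, j))" if "i < length vs" "j < length vs" for i j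
    using that by (simp add: hermitian_adjacency_index cnj_arc_weight)
  from hermitian_quadratic[OF hermitian_adjacency_carrier this _ ij(1,2), of r s] spec
  have "(\<Sum>k<length vs. ?H $$ (i, k) * ?H $$ (k, j))
    = of_real (r + s) * ?H $$ (i, j) - (if i = j then of_real (r * s) else 0)"
    by simp
  moreover have "i = j \<longleftrightarrow> u = v"
    using ij vs(1) by (simp add: nth_eq_iff_index_eq)
  ultimately show ?thesis
    using ij sum_nth_distinct[OF vs(1), of "\<lambda>w. arc_weight G u w * arc_weight G w v"] vs(2)
    by (simp add: hermitian_adjacency_index)
qed

lemma card_neighbours:
  assumes reg: "\<And>v. v \<in> pverts G \<Longrightarrow> in_degree (with_proj G) v = k \<and> out_degree (with_proj G) v = k"
    and u: "u \<in> pverts G"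
  shows "card {w. (u, w) \<in> parcs G} = k" "card {w. (w, u) \<in> parcs G} = k"
proof -
  have "out_arcs (with_proj G) u = Pair u ` {w. (u, w) \<in> parcs G}" by auto
  then show "card {w. (u, w) \<in> parcs G} = k"
    using reg[OF u] by (simp add: out_degree_def card_image inj_on_def)
  have "in_arcs (with_proj G) u = (\<lambda>w. (w, u)) ` {w. (w, u) \<in> parcs G}" by force
  then show "card {w. (w, u) \<in> parcs G} = k"
    using reg[OF u] by (simp add: in_degree_def card_image inj_on_def)
qed

lemma finite_neighbours [simp]:
  "finite {w. (u, w) \<in> parcs G}" "finite {w. (w, u) \<in> parcs G}"
  by (rule finite_subset[OF _ pair_finite_verts], use wellformed' in auto)+

section \<open>Row sums and walks of length two\<close>

text \<open>Out-neighbours contribute \<omega> and in-neighbours \<open>cnj \<omega>\<close>,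
  equally often, and \<open>\<omega> + cnj \<omega> = 1\<close>. This makes the all-ones vector an
  eigenvector.\<close>

lemma sum_arc_weight:
  assumes "card {w. (u, w) \<in> parcs G} = k" "card {w. (w, u) \<in> parcs G} = k"
  shows "(\<Sum>w\<in>pverts G. arc_weight G u w) = of_nat k"
proof -
  have "(\<Sum>w\<in>pverts G. arc_weight G u w)
    = (\<Sum>w\<in>pverts G. (if (u, w) \<in> parcs G then \<omega> else 0) + (if (w, u) \<in> parcs G then cnj \<omega> else 0))"
    using antiparallel_free by (intro sum.cong) (auto simp: arc_weight_def)
  also have "\<dots> = of_nat (card {w \<in> pverts G. (u, w) \<in> parcs G}) * \<omega>
      + of_nat (card {w \<in> pverts G. (w, u) \<in> parcs G}) * cnj \<omega>"
    by (simp add: sum.distrib sum.If_cases pair_finite_verts Int_def)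
  also have "{w \<in> pverts G. (u, w) \<in> parcs G} = {w. (u, w) \<in> parcs G}"
    using wellformed' by auto
  also have "{w \<in> pverts G. (w, u) \<in> parcs G} = {w. (w, u) \<in> parcs G}"
    using wellformed' by auto
  also have "of_nat (card {w. (u, w) \<in> parcs G}) * \<omega>
      + of_nat (card {w. (w, u) \<in> parcs G}) * cnj \<omega> = of_nat k * (\<omega> + cnj \<omega>)"
    using assms by (simp add: algebra_simps)
  finally show ?thesis by (simp add: omega_simps)
qed

text \<open>A diagonal entry of the squared matrix: each of the 2 k neighbours contributes
  \<open>\<omega> * cnj \<omega> = 1\<close>.\<close>

lemma sum_arc_weight_norm:
  assumes "card {w. (u, w) \<in> parcs G} = k" "card {w. (w, u) \<in> parcs G} = k"
  shows "(\<Sum>w\<in>pverts G. arc_weight G u w * arc_weight G w u) = of_nat (2 * k)"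
proof -
  have "(\<Sum>w\<in>pverts G. arc_weight G u w * arc_weight G w u)
    = (\<Sum>w\<in>pverts G. (if (u, w) \<in> parcs G then 1 else 0) + (if (w, u) \<in> parcs G then 1 else 0))"
    using antiparallel_free by (intro sum.cong) (auto simp: arc_weight_def omega_simps)
  also have "\<dots> = of_nat (card {w \<in> pverts G. (u, w) \<in> parcs G})
      + of_nat (card {w \<in> pverts G. (w, u) \<in> parcs G})"
    by (simp add: sum.distrib sum.If_cases pair_finite_verts Int_def)
  also have "{w \<in> pverts G. (u, w) \<in> parcs G} = {w. (u, w) \<in> parcs G}"
    using wellformed' by auto
  also have "{w \<in> pverts G. (w, u) \<in> parcs G} = {w. (w, u) \<in> parcs G}"
    using wellformed' by auto
  finally show ?thesis using assms by simp
qed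

text \<open>The walks u - w - v are sorted by the directions of their arcs: directed from u to v,
  directed from v to u, or with both arcs pointing towards w or both away from it. In the last case
  the weights \<omega> and \<open>cnj \<omega>\<close> multiply to 1.\<close>

lemma sum_arc_weight_paths:
  "(\<Sum>w\<in>pverts G. arc_weight G u w * arc_weight G w v)
    = of_nat (card {w. (u, w) \<in> parcs G \<and> (w, v) \<in> parcs G}) * (\<omega> * \<omega>)
    + of_nat (card {w. (v, w) \<in> parcs G \<and> (w, u) \<in> parcs G}) * (cnj \<omega> * cnj \<omega>)
    + of_nat (card {w. (u, w) \<in> parcs G \<and> (v, w) \<in> parcs G \<or> (w, u) \<in> parcs G \<and> (w, v) \<in> parcs G})"
proof -
  let ?S1 = "{w. (u, w) \<in> parcs G \<and> (w, v) \<in> parcs G}"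
  let ?S2 = "{w. (v, w) \<in> parcs G \<and> (w, u) \<in> parcs G}"
  let ?S3 = "{w. (u, w) \<in> parcs G \<and> (v, w) \<in> parcs G \<or> (w, u) \<in> parcs G \<and> (w, v) \<in> parcs G}"
  have "(\<Sum>w\<in>pverts G. arc_weight G u w * arc_weight G w v)
    = (\<Sum>w\<in>pverts G. (if w \<in> ?S1 then \<omega> * \<omega> else 0) + (if w \<in> ?S2 then cnj \<omega> * cnj \<omega> else 0)
      + (if w \<in> ?S3 then 1 else 0))"
  proof (intro sum.cong refl)
    fix w
    show "arc_weight G u w * arc_weight G w v
      = (if w \<in> ?S1 then \<omega> * \<omega> else 0) + (if w \<in> ?S2 then cnj \<omega> * cnj \<omega> else 0)
        + (if w \<in> ?S3 then 1 else 0)"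
      using antiparallel_free[of u w] antiparallel_free[of v w]
      by (cases "(u, w) \<in> parcs G"; cases "(w, u) \<in> parcs G";
          cases "(v, w) \<in> parcs G"; cases "(w, v) \<in> parcs G")
        (simp_all add: arc_weight_def omega_simps(2,3))
  qed
  also have "\<dots> = of_nat (card (pverts G \<inter> ?S1)) * (\<omega> * \<omega>)
    + of_nat (card (pverts G \<inter> ?S2)) * (cnj \<omega> * cnj \<omega>) + of_nat (card (pverts G \<inter> ?S3))"
    by (simp only: sum.distrib sum.If_cases[OF pair_finite_verts] Collect_mem_eq sum_constant) simp
  also have "pverts G \<inter> ?S1 = ?S1"
    using wellformed' by auto
  also have "pverts G \<inter> ?S2 = ?S2"
    using wellformed' by auto
  also have "pverts G \<inter> ?S3 = ?S3"
    using wellformed' by auto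
  finally show ?thesis .
qed

section \<open>The eigenvalues in terms of the degree\<close>

lemma regular_eigenvalues:
  assumes vs: "distinct vs" "set vs = pverts G" and ne: "pverts G \<noteq> {}"
    and spec: "spectrum (hermitian_adjacency G vs) = {complex_of_real r, complex_of_real s}"
    and rs: "r > s"
    and deg: "\<And>u. u \<in> pverts G \<Longrightarrow>
      card {w. (u, w) \<in> parcs G} = k \<and> card {w. (w, u) \<in> parcs G} = k"
  shows "r = k" "s = -2" "k > 0"
proof -
  let ?H = "hermitian_adjacency G vs" and ?n = "length vs"
  let ?one = "Matrix.vec ?n (\<lambda>_. 1 :: complex)"
  have n: "?n > 0" using ne vs(2) by auto
  obtain u where u: "u \<in> pverts G" using ne by blast
  have "?H *\<^sub>v ?one = of_nat k \<cdot>\<^sub>v ?one"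
  proof (rule eq_vecI)
    fix i assume "i < dim_vec (of_nat k \<cdot>\<^sub>v ?one)"
    then have i: "i < ?n" by simp
    have "(?H *\<^sub>v ?one) $ i = (\<Sum>j<?n. arc_weight G (vs ! i) (vs ! j))"
      using i hermitian_adjacency_carrier[of G vs]
      by (simp add: scalar_prod_def lessThan_atLeast0 hermitian_adjacency_index)
    also have "\<dots> = of_nat k"
      using sum_nth_distinct[OF vs(1), of "arc_weight G (vs ! i)"] sum_arc_weight deg vs(2) i
      by (metis nth_mem)
    finally show "(?H *\<^sub>v ?one) $ i = (of_nat k \<cdot>\<^sub>v ?one) $ i" using i by simp
  qed (simp add: hermitian_adjacency_def)
  moreover have "?one \<noteq> 0\<^sub>v ?n"
    using n by (metis index_vec index_zero_vec(1) zero_neq_one)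
  ultimately have "of_nat k \<in> spectrum ?H"
    unfolding spectrum_def eigenvalue_def eigenvector_def
    using hermitian_adjacency_carrier[of G vs] by (auto intro!: exI[of _ ?one])
  then have "complex_of_real (real k) = of_real r \<or> complex_of_real (real k) = of_real s"
    using spec by simp
  then have k: "real k = r \<or> real k = s" by (simp only: of_real_eq_iff)
  have "complex_of_real (2 * real k) = of_real (- (r * s))"
    using spectrum_quadratic[OF vs spec u u] sum_arc_weight_norm deg[OF u] by simp
  then have rs2: "2 * real k = - (r * s)" by (simp only: of_real_eq_iff)
  \<comment> \<open>For k = 0 there are no arcs, so the matrix is zero and 0 is its only possible
    eigenvalue, against r > s.\<close>
  show pos: "k > 0"
  proof (rule ccontr)
    assume "\<not> k > 0"
    have "(u, w) \<notin> parcs G" for u w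
    proof
      assume uw: "(u, w) \<in> parcs G"
      have "card {w. (u, w) \<in> parcs G} = 0"
        using deg[OF in_arcsD1[OF uw]] \<open>\<not> k > 0\<close> by simp
      with uw show False by (simp add: card_eq_0_iff)
    qed
    then have H0: "?H = 0\<^sub>m ?n ?n" by (auto simp: hermitian_adjacency_def)
    have "c = 0" if "c \<in> spectrum ?H" for c
    proof -
      obtain v where "eigenvector (0\<^sub>m ?n ?n) v c"
        using \<open>c \<in> spectrum ?H\<close> unfolding spectrum_def eigenvalue_def H0 by blast
      then have v: "v \<in> carrier_vec ?n" "v \<noteq> 0\<^sub>v ?n" "0\<^sub>m ?n ?n *\<^sub>v v = c \<cdot>\<^sub>v v"
        by (simp_all add: eigenvector_def)
      from v(1,2) obtain i where i: "i < ?n" "v $ i \<noteq> 0" by (metis carrier_vecD eq_vecI index_zero_vec)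
      have "(0\<^sub>m ?n ?n *\<^sub>v v) $ i = c * v $ i" using v(1,3) i by simp
      then show "c = 0" using i v(1) by simp
    qed
    then have "r = 0" "s = 0" using spec by auto
    with rs show False by simp
  qed
  \<comment> \<open>The alternative s = k turns 2 k = - r s into r = -2, which is below s =
    k.\<close>
  show r: "r = k"
  proof (rule ccontr)
    assume "r \<noteq> k"
    with k have "s = k" by simp
    with rs2 have "real k * (r + 2) = 0" by (simp add: algebra_simps)
    with pos have "r = -2" by simp
    with rs \<open>s = k\<close> show False by simp
  qed
  have "real k * (s + 2) = 0" using rs2 r by (simp add: algebra_simps)
  with pos show "s = -2" by simp
qed

section \<open>Orthogonal rows and common neighbours\<close>

lemma card_paths_eq:
  assumes "(\<Sum>w\<in>pverts G. arc_weight G u w * arc_weight G w v) = 0"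
  defines "c \<equiv> card {w. (u, w) \<in> parcs G \<and> (v, w) \<in> parcs G \<or> (w, u) \<in> parcs G \<and> (w, v) \<in> parcs G}"
  shows "card {w. (u, w) \<in> parcs G \<and> (w, v) \<in> parcs G} = c"
    and "card {w. (v, w) \<in> parcs G \<and> (w, u) \<in> parcs G} = c"
  using Eisenstein_sum_eq_0[OF assms(1)[unfolded sum_arc_weight_paths]] by (simp_all add: c_def)

text \<open>The three kinds of walks partition the common neighbours, disjointly because no arc has
  an opposite arc, and by \<open>card_paths_eq\<close> they are equally numerous.\<close>

lemma card_common_neighbours:
  assumes "(\<Sum>w\<in>pverts G. arc_weight G u w * arc_weight G w v) = 0"
  defines "E \<equiv> parcs (underlying_graph G)"
  shows "card (E `` {u} \<inter> E `` {v}) = 3 * card {w. (u, w) \<in> parcs G \<and> (w, v) \<in> parcs G}"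
proof -
  let ?S1 = "{w. (u, w) \<in> parcs G \<and> (w, v) \<in> parcs G}"
  let ?S2 = "{w. (v, w) \<in> parcs G \<and> (w, u) \<in> parcs G}"
  let ?S3 = "{w. (u, w) \<in> parcs G \<and> (v, w) \<in> parcs G \<or> (w, u) \<in> parcs G \<and> (w, v) \<in> parcs G}"
  have fin: "finite ?S1" "finite ?S2" "finite ?S3"
    by (rule finite_subset[OF _ pair_finite_verts], use wellformed' in auto)+
  have disj: "?S1 \<inter> (?S2 \<union> ?S3) = {}" "?S2 \<inter> ?S3 = {}"
    using antiparallel_free by blast+
  have "E `` {u} \<inter> E `` {v} = ?S1 \<union> (?S2 \<union> ?S3)"
    by (auto simp: E_def)
  then have "card (E `` {u} \<inter> E `` {v}) = card (?S1 \<union> (?S2 \<union> ?S3))"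
    by (rule arg_cong)
  also have "\<dots> = card ?S1 + card (?S2 \<union> ?S3)"
    by (rule card_Un_disjoint[OF fin(1) finite_UnI[OF fin(2,3)] disj(1)])
  also have "card (?S2 \<union> ?S3) = card ?S2 + card ?S3"
    by (rule card_Un_disjoint[OF fin(2,3) disj(2)])
  finally show ?thesis by (simp only: card_paths_eq[OF assms(1)])
qed

text \<open>A common neighbour of an arc's ends forces one path of each of the three kinds, so its tail has
  three out-neighbours or its head has three in-neighbours.\<close>

lemma no_common_neighbour_of_arc:
  assumes "(\<Sum>w\<in>pverts G. arc_weight G u w * arc_weight G w v) = 0"
    and "card {w. (u, w) \<in> parcs G} = 2" "card {w. (w, v) \<in> parcs G} = 2"
    and uv: "(u, v) \<in> parcs G"
    and w: "(u, w) \<in> parcs (underlying_graph G)" "(v, w) \<in> parcs (underlying_graph G)"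
  shows False
proof -
  let ?E = "parcs (underlying_graph G)"
  have "finite (?E `` {u} \<inter> ?E `` {v})"
    by (rule finite_subset[OF _ pair_finite_verts]) (use wellformed' in auto)
  moreover have "w \<in> ?E `` {u} \<inter> ?E `` {v}" using w by blast
  ultimately have "card (?E `` {u} \<inter> ?E `` {v}) \<noteq> 0" by (auto simp: card_eq_0_iff)
  then have ne: "card {w. (u, w) \<in> parcs G \<and> (w, v) \<in> parcs G} \<noteq> 0"
    using card_common_neighbours[OF assms(1)] by simp
  then obtain a where a: "(u, a) \<in> parcs G" "(a, v) \<in> parcs G"
    by (auto simp: card_eq_0_iff)
  from ne have "card {w. (u, w) \<in> parcs G \<and> (v, w) \<in> parcs G \<or> (w, u) \<in> parcs G \<and> (w, v) \<in> parcs G} \<noteq> 0"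
    using card_paths_eq(1)[OF assms(1)] by simp
  then obtain b where b: "(u, b) \<in> parcs G \<and> (v, b) \<in> parcs G \<or> (b, u) \<in> parcs G \<and> (b, v) \<in> parcs G"
    by (auto simp: card_eq_0_iff)
  have irr: "(x, x) \<notin> parcs G" for x using antiparallel_free by blast
  from b show False
  proof
    assume b: "(u, b) \<in> parcs G \<and> (v, b) \<in> parcs G"
    \<comment> \<open>a and b differ because a \<rightarrow> v while v \<rightarrow> b; together
      with v they are out-neighbours of u.\<close>
    have "a \<noteq> b" "a \<noteq> v" "b \<noteq> v" using a b antiparallel_free irr by blast+
    moreover have "card {v, a, b} \<le> card {w. (u, w) \<in> parcs G}"
      using a b uv by (intro card_mono) auto
    ultimately show False using assms(2) by simp
  next
    assume b: "(b, u) \<in> parcs G \<and> (b, v) \<in> parcs G"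
    have "a \<noteq> b" "a \<noteq> u" "b \<noteq> u" using a b antiparallel_free irr by blast+
    moreover have "card {u, a, b} \<le> card {w. (w, v) \<in> parcs G}"
      using a b uv by (intro card_mono) auto
    ultimately show False using assms(3) by simp
  qed
qed

lemma connected_rtrancl:
  assumes "Digraph_Component.connected (with_proj G)" "u \<in> pverts G" "v \<in> pverts G"
  shows "(u, v) \<in> (parcs (underlying_graph G))\<^sup>*"
proof -
  have "u \<rightarrow>\<^sup>*\<^bsub>with_proj (underlying_graph G)\<^esub> v"
    using assms by (auto simp: connected_def strongly_connected_def)
  then show ?thesis
    unfolding reachable_def by (auto dest: rtrancl_on_rtranclI)
qed

text \<open>This reduces to \<open>bij_betw_K55_minus_M\<close>: the degree is 2 + 2 = 4, and a
  number of common neighbours that is a nonzero multiple of 3 and at most 4 equals 3.\<close>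

lemma iso_K55_minus_M:
  assumes conn: "Digraph_Component.connected (with_proj G)"
    and tri: "triangle_free (underlying_graph G)"
    and deg: "\<And>u. u \<in> pverts G \<Longrightarrow>
      card {w. (u, w) \<in> parcs G} = 2 \<and> card {w. (w, u) \<in> parcs G} = 2"
    and ortho: "\<And>u v. u \<in> pverts G \<Longrightarrow> v \<in> pverts G \<Longrightarrow> u \<noteq> v \<Longrightarrow>
      (\<Sum>w\<in>pverts G. arc_weight G u w * arc_weight G w v) = 0"
  shows "digraph_iso (with_proj (underlying_graph G)) (with_proj K55_minus_M)"
proof -
  define E where "E = parcs (underlying_graph G)"
  have E_iff: "(x, y) \<in> E \<longleftrightarrow> (x, y) \<in> parcs G \<or> (y, x) \<in> parcs G" for x y
    by (simp add: E_def)
  have ne: "pverts G \<noteq> {}"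
    using conn by (simp add: connected_def strongly_connected_def)
  have E4: "card (E `` {u}) = 4" if "u \<in> pverts G" for u
  proof -
    have "E `` {u} = {w. (u, w) \<in> parcs G} \<union> {w. (w, u) \<in> parcs G}" by (auto simp: E_iff)
    then have "card (E `` {u}) = card ({w. (u, w) \<in> parcs G} \<union> {w. (w, u) \<in> parcs G})"
      by (rule arg_cong)
    also have "\<dots> = card {w. (u, w) \<in> parcs G} + card {w. (w, u) \<in> parcs G}"
    proof (rule card_Un_disjoint)
      show "{w. (u, w) \<in> parcs G} \<inter> {w. (w, u) \<in> parcs G} = {}"
        using antiparallel_free by blast
    qed simp_all
    also have "\<dots> = 4" using deg[OF that] by simp
    finally show ?thesis by simp
  qed
  have "\<exists>f. bij_betw f (pverts G) (pverts K55_minus_M) \<and>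
    (\<forall>x\<in>pverts G. \<forall>y\<in>pverts G. (x, y) \<in> E \<longleftrightarrow> (f x, f y) \<in> parcs K55_minus_M)"
  proof (rule bij_betw_K55_minus_M[OF pair_finite_verts ne])
    show "E \<subseteq> pverts G \<times> pverts G" using wellformed' by (auto simp: E_iff)
    show "sym E" by (auto simp: sym_def E_iff)
    show "(u, v) \<in> E\<^sup>*" if "u \<in> pverts G" "v \<in> pverts G" for u v
      using connected_rtrancl[OF conn that] by (simp add: E_def)
    show "(w, u) \<notin> E" if "(u, v) \<in> E" "(v, w) \<in> E" for u v w
    proof
      assume wu: "(w, u) \<in> E"
      have "x \<noteq> y" if "(x, y) \<in> E" for x y
        using that antiparallel_free by (auto simp: E_iff)
      then have "distinct [u, v, w]" using that wu by auto
      then show False using tri that wu unfolding triangle_free_def E_def[symmetric] by blast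
    qed
    show "card (E `` {u}) = 4" if "u \<in> pverts G" for u by (rule E4[OF that])
    show "card (E `` {u} \<inter> E `` {v}) = 3"
      if "u \<in> pverts G" "v \<in> pverts G" "u \<noteq> v" "E `` {u} \<inter> E `` {v} \<noteq> {}" for u v
    proof -
      have fin: "finite (E `` {u})" using E4[OF that(1)] card.infinite by fastforce
      then have "card (E `` {u} \<inter> E `` {v}) \<noteq> 0" using that(4) by simp
      moreover have "card (E `` {u} \<inter> E `` {v}) \<le> 4"
        using card_mono[OF fin, of "E `` {u} \<inter> E `` {v}"] E4[OF that(1)] by simp
      moreover have "\<exists>c. card (E `` {u} \<inter> E `` {v}) = 3 * c"
        using card_common_neighbours[OF ortho[OF that(1-3)]] unfolding E_def by blast
      ultimately show ?thesis by auto
    qed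
  qed
  then obtain f where "bij_betw f (pverts G) (pverts K55_minus_M)"
    "\<And>x y. x \<in> pverts G \<Longrightarrow> y \<in> pverts G \<Longrightarrow> (x, y) \<in> E \<longleftrightarrow> (f x, f y) \<in> parcs K55_minus_M"
    by blast
  then show ?thesis
    by (intro digraph_iso_with_projI[of _ _ f])
      (auto simp: E_def K55_minus_M_def K55_def simp del: parcs_underlying_graph
        intro: wellformed_mk_symmetric pair_wf_digraph.intro)
qed

end

theorem theorem2p9:
  fixes D :: "'a pair_pre_digraph" and vs :: "'a list" and r s :: real
  assumes "oriented_graph D"
    and "Digraph_Component.connected (with_proj D)"
    and "regular_digraph (with_proj D)"
    and "distinct vs" and "set vs = pverts D"
    and "spectrum (hermitian_adjacency D vs) = {complex_of_real r, complex_of_real s}"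
    and "r > s"
  shows "(r = 2 \<longleftrightarrow> triangle_free (underlying_graph D)) \<and>
    (triangle_free (underlying_graph D) \<longleftrightarrow>
      digraph_iso (with_proj (underlying_graph D)) (with_proj K55_minus_M))"
proof -
  interpret oriented_graph D by fact
  have ne: "pverts D \<noteq> {}"
    using assms(2) by (simp add: connected_def strongly_connected_def)
  obtain k where deg: "\<And>u. u \<in> pverts D \<Longrightarrow>
      card {w. (u, w) \<in> parcs D} = k \<and> card {w. (w, u) \<in> parcs D} = k"
    using assms(3) card_neighbours unfolding regular_digraph_def by fastforce
  note k = regular_eigenvalues[OF assms(4,5) ne assms(6,7) deg]
  \<comment> \<open>Off the diagonal the r s term is absent, and s = -2 turns r + s into r - 2. So
    distinct rows are orthogonal when r = 2.\<close>
  have quad: "(\<Sum>w\<in>pverts D. arc_weight D u w * arc_weight D w v) = of_real (r - 2) * arc_weight D u v"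
    if "u \<in> pverts D" "v \<in> pverts D" "u \<noteq> v" for u v
    using spectrum_quadratic[OF assms(4-6) that(1,2)] that(3) k(2) by simp
  have no_arc_triangle: False
    if "r = 2" "(u, v) \<in> parcs D" "(u, w) \<in> parcs (underlying_graph D)"
      "(v, w) \<in> parcs (underlying_graph D)" for u v w
  proof (rule no_common_neighbour_of_arc[OF _ _ _ that(2-4)])
    show "(\<Sum>w\<in>pverts D. arc_weight D u w * arc_weight D w v) = 0"
      using quad[OF in_arcsD1[OF that(2)] in_arcsD2[OF that(2)]] that(1,2) antiparallel_free
      by fastforce
    show "card {w. (u, w) \<in> parcs D} = 2" "card {w. (w, v) \<in> parcs D} = 2"
      using deg that(1,2) k(1) wellformed' by auto
  qed
  have "triangle_free (underlying_graph D)" if "r = 2"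
    unfolding triangle_free_def
  proof
    assume "\<exists>u v w. distinct [u, v, w] \<and> (u, v) \<in> parcs (underlying_graph D) \<and>
      (v, w) \<in> parcs (underlying_graph D) \<and> (w, u) \<in> parcs (underlying_graph D)"
    then obtain u v w where uvw: "(u, v) \<in> parcs D \<or> (v, u) \<in> parcs D"
      "(v, w) \<in> parcs (underlying_graph D)" "(u, w) \<in> parcs (underlying_graph D)"
      by auto
    \<comment> \<open>The edge u v is an arc in one direction or the other; the two ends exchange
      roles in the second case.\<close>
    from uvw(1) show False
      using no_arc_triangle[OF that _ uvw(3,2)] no_arc_triangle[OF that _ uvw(2,3)] by blast
  qed
  \<comment> \<open>An arc (u, v) exists since k > 0. Without triangles its ends have no common
    neighbour, so the left side of \<open>quad\<close> vanishes while the right side is (r - 2)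
    \<omega>.\<close>
  moreover have r2: "r = 2" if tri: "triangle_free (underlying_graph D)"
  proof -
    obtain u where u: "u \<in> pverts D" using ne by blast
    with deg k(3) have "{w. (u, w) \<in> parcs D} \<noteq> {}" by fastforce
    then obtain v where uv: "(u, v) \<in> parcs D" by blast
    have irr: "(x, x) \<notin> parcs D" for x using antiparallel_free by blast
    have "arc_weight D u w * arc_weight D w v = 0" for w
    proof (rule ccontr)
      assume "arc_weight D u w * arc_weight D w v \<noteq> 0"
      then have "(u, w) \<in> parcs (underlying_graph D)" "(w, v) \<in> parcs (underlying_graph D)"
        by (auto simp: arc_weight_def split: if_splits)
      moreover have "distinct [u, w, v]" using calculation uv irr by auto
      ultimately show False using tri uv unfolding triangle_free_def by auto
    qed
    then have "of_real (r - 2) * \<omega> = 0"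
      using quad[of u v] uv irr in_arcsD1 in_arcsD2 by (auto simp: arc_weight_def)
    then have "r - 2 = 0" using omega_simps(6) by (simp only: mult_eq_0_iff of_real_eq_0_iff) simp
    then show "r = 2" by simp
  qed
  moreover have "digraph_iso (with_proj (underlying_graph D)) (with_proj K55_minus_M)"
    if tri: "triangle_free (underlying_graph D)"
  proof (rule iso_K55_minus_M[OF assms(2) tri])
    have "k = 2" using r2[OF tri] k(1) by simp
    then show "card {w. (u, w) \<in> parcs D} = 2 \<and> card {w. (w, u) \<in> parcs D} = 2"
      if "u \<in> pverts D" for u using deg[OF that] by simp
    show "(\<Sum>w\<in>pverts D. arc_weight D u w * arc_weight D w v) = 0"
      if "u \<in> pverts D" "v \<in> pverts D" "u \<noteq> v" for u v
      using quad[OF that] r2[OF tri] by simp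
  qed
  ultimately show ?thesis using triangle_free_if_iso_K55_minus_M by blast
qed

end
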